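(* Let $k$ be a field, let $q\in k^{\times}$ be not a root of unity, and let $n\ge 0$ be an integer. If $P\subset A^{(n)}$ is a nonzero prime ideal, then $P$ contains a nonzero bi-homogeneous polynomial which, viewed as an element of the commutative polynomial ring $A_c^{(n)}$, is irreducible.
   Context: Let $B^{(n)}=k\langle x,x',\dots,x^{(n)},y,y',\dots,y^{(n)}\rangle$ be the free associative (noncommutative) unital $k$-algebra on the $2n+2$ indeterminates $x=x^{(0)},x'=x^{(1)},\dots,x^{(n)},y=y^{(0)},y'=y^{(1)},\dots,y^{(n)}$. Let $A^{(n)}$ be the quotient of $B^{(n)}$ by the two-sided ideal generated by all elements $x^{(i)}x^{(j)}-x^{(j)}x^{(i)}$, $\;y^{(i)}y^{(j)}-y^{(j)}y^{(i)}$, $\;y^{(i)}x^{(j)}-q\,x^{(j)}y^{(i)}$ for $0\le i,j\le n$. Let $A_c^{(n)}=k[x,x',\dots,x^{(n)},y,y',\dots,y^{(n)}]$ be the usual commutative polynomial ring. The sets $A^{(n)}$ and $A_c^{(n)}$ are identified via the unique $k$-linear bijection sending the class in $A^{(n)}$ of each ordered monomial $x^{i_0}(x')^{i_1}\cdots(x^{(n)})^{i_n}y^{j_0}(y')^{j_1}\cdots(y^{(n)})^{j_n}$ to the same monomial in $A_c^{(n)}$ (this is not a ring isomorphism). The bi-degree of such a monomial is $(i_0+\dots+i_n,\;j_0+\dots+j_n)$. An element of $A^{(n)}$ (or $A_c^{(n)}$) is bi-homogeneous if it is a $k$-linear combination of such monomials all of the same bi-degree. Ideals of $A^{(n)}$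 are two-sided. An ideal $P$ is prime if $P\ne(1)$ and $ab\in P$ implies $a\in P$ or $b\in P$ for all elements $a,b$. *)

theory Defs
  imports "HOL-Algebra.Algebra" "HOL-Library.Poly_Mapping"
begin

datatype 'a word = Word (letters: "'a list")

instantiation word :: (type) monoid_add
begin

definition zero_word :: "'a word" where "0 = Word []"

definition plus_word :: "'a word \<Rightarrow> 'a word \<Rightarrow> 'a word"
  where "u + v = Word (letters u @ letters v)"

instance by standard (auto simp: zero_word_def plus_word_def)

end

text \<open>The indeterminates: \<open>XV i\<close> is $x^{(i)}$ and \<open>YV i\<close> is $y^{(i)}$.\<close>

datatype gen = XV nat | YV nat

definition gens :: "nat \<Rightarrow> gen set"
  where "gens n = XV ` {..n} \<union> YV ` {..n}"

text \<open>Words form the free monoid (written additively), so the convolution product of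
  finitely supported functions on words is the product of the free algebra; in the same way,
  finitely supported functions on exponent vectors are commutative polynomials.\<close>

definition free_alg :: "nat \<Rightarrow> (gen word \<Rightarrow>\<^sub>0 'k::field) ring"
  where "free_alg n =
    \<lparr>carrier = {p. \<forall>w\<in>Poly_Mapping.keys p. set (letters w) \<subseteq> gens n},
     monoid.mult = (*), one = 1, ring.zero = 0, ring.add = (+)\<rparr>"

definition comm_alg :: "nat \<Rightarrow> ((gen \<Rightarrow>\<^sub>0 nat) \<Rightarrow>\<^sub>0 'k::field) ring"
  where "comm_alg n =
    \<lparr>carrier = {f. \<forall>m\<in>Poly_Mapping.keys f. Poly_Mapping.keys m \<subseteq> gens n},
     monoid.mult = (*), one = 1, ring.zero = 0, ring.add = (+)\<rparr>"

definition var :: "gen \<Rightarrow> gen word \<Rightarrow>\<^sub>0 'k::field"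
  where "var g = Poly_Mapping.single (Word [g]) 1"

definition scalar :: "'k \<Rightarrow> gen word \<Rightarrow>\<^sub>0 'k::field"
  where "scalar c = Poly_Mapping.single 0 c"

definition relators :: "nat \<Rightarrow> 'k \<Rightarrow> (gen word \<Rightarrow>\<^sub>0 'k::field) set"
  where "relators n q =
    {var (XV i) * var (XV j) - var (XV j) * var (XV i) | i j. i \<le> n \<and> j \<le> n} \<union>
    {var (YV i) * var (YV j) - var (YV j) * var (YV i) | i j. i \<le> n \<and> j \<le> n} \<union>
    {var (YV i) * var (XV j) - scalar q * var (XV j) * var (YV i) | i j. i \<le> n \<and> j \<le> n}"

definition rel_ideal :: "nat \<Rightarrow> 'k \<Rightarrow> (gen word \<Rightarrow>\<^sub>0 'k::field) set"
  where "rel_ideal n q = Idl\<^bsub>free_alg n\<^esub> (relators n q)"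

definition q_alg :: "nat \<Rightarrow> 'k \<Rightarrow> (gen word \<Rightarrow>\<^sub>0 'k::field) set ring"
  where "q_alg n q = free_alg n Quot rel_ideal n q"

text \<open>The ordered word $x^{i_0}(x')^{i_1}\cdots(x^{(n)})^{i_n}y^{j_0}\cdots(y^{(n)})^{j_n}$ of an
  exponent vector.\<close>

definition ordered_word :: "nat \<Rightarrow> (gen \<Rightarrow>\<^sub>0 nat) \<Rightarrow> gen word"
  where "ordered_word n m =
    Word (concat (map (\<lambda>g. replicate (Poly_Mapping.lookup m g) g)
      (map XV [0..<Suc n] @ map YV [0..<Suc n])))"

definition ordered_lift :: "nat \<Rightarrow> ((gen \<Rightarrow>\<^sub>0 nat) \<Rightarrow>\<^sub>0 'k::field) \<Rightarrow> gen word \<Rightarrow>\<^sub>0 'k"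
  where "ordered_lift n f =
    (\<Sum>m\<in>Poly_Mapping.keys f. Poly_Mapping.single (ordered_word n m) (Poly_Mapping.lookup f m))"

definition of_comm :: "nat \<Rightarrow> 'k \<Rightarrow> ((gen \<Rightarrow>\<^sub>0 nat) \<Rightarrow>\<^sub>0 'k::field) \<Rightarrow> (gen word \<Rightarrow>\<^sub>0 'k) set"
  where "of_comm n q f = rel_ideal n q +>\<^bsub>free_alg n\<^esub> ordered_lift n f"

text \<open>The identification of the two underlying vector spaces; \<open>of_comm\<close> is bijective between
  the carriers by \<open>bij_betw_of_comm\<close> below.\<close>

definition to_comm :: "nat \<Rightarrow> 'k \<Rightarrow> (gen word \<Rightarrow>\<^sub>0 'k::field) set \<Rightarrow> (gen \<Rightarrow>\<^sub>0 nat) \<Rightarrow>\<^sub>0 'k"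
  where "to_comm n q = inv_into (carrier (comm_alg n)) (of_comm n q)"

definition bidegree :: "nat \<Rightarrow> (gen \<Rightarrow>\<^sub>0 nat) \<Rightarrow> nat \<times> nat"
  where "bidegree n m =
    (\<Sum>i\<le>n. Poly_Mapping.lookup m (XV i), \<Sum>i\<le>n. Poly_Mapping.lookup m (YV i))"

definition bihomogeneous :: "nat \<Rightarrow> ((gen \<Rightarrow>\<^sub>0 nat) \<Rightarrow>\<^sub>0 'k::field) \<Rightarrow> bool"
  where "bihomogeneous n f \<longleftrightarrow> (\<exists>d. \<forall>m\<in>Poly_Mapping.keys f. bidegree n m = d)"

text \<open>The library's \<open>primeideal\<close> is restricted to commutative rings.\<close>

definition completely_prime :: "'a set \<Rightarrow> ('a, 'b) ring_scheme \<Rightarrow> bool"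
  where "completely_prime P R \<longleftrightarrow> ideal P R \<and> P \<noteq> carrier R \<and>
    (\<forall>a\<in>carrier R. \<forall>b\<in>carrier R. a \<otimes>\<^bsub>R\<^esub> b \<in> P \<longrightarrow> a \<in> P \<or> b \<in> P)"

lemma free_alg_simps [simp]:
  "carrier (free_alg n) = {p. \<forall>w\<in>Poly_Mapping.keys p. set (letters w) \<subseteq> gens n}"
  "a \<otimes>\<^bsub>free_alg n\<^esub> b = a * b" "\<one>\<^bsub>free_alg n\<^esub> = 1" "\<zero>\<^bsub>free_alg n\<^esub> = 0" "a \<oplus>\<^bsub>free_alg n\<^esub> b = a + b"
  by (auto simp: free_alg_def)

lemma comm_alg_simps [simp]:
  "carrier (comm_alg n) = {f. \<forall>m\<in>Poly_Mapping.keys f. Poly_Mapping.keys m \<subseteq> gens n}"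
  "a \<otimes>\<^bsub>comm_alg n\<^esub> b = a * b" "\<one>\<^bsub>comm_alg n\<^esub> = 1" "\<zero>\<^bsub>comm_alg n\<^esub> = 0" "a \<oplus>\<^bsub>comm_alg n\<^esub> b = a + b"
  by (auto simp: comm_alg_def)

lemma letters_simps [simp]: "letters 0 = []" "letters (u + v) = letters u @ letters v"
  by (auto simp: zero_word_def plus_word_def)

lemma ring_free_alg: "ring (free_alg n :: (gen word \<Rightarrow>\<^sub>0 'a::field) ring)" (is "ring ?R")
proof (rule ringI)
  have add: "a + b \<in> carrier ?R" if "a \<in> carrier ?R" "b \<in> carrier ?R" for a b
    using that keys_add[of a b] by auto
  have mul: "a * b \<in> carrier ?R" if "a \<in> carrier ?R" "b \<in> carrier ?R" for a b
  proof -
    have "set (letters m) \<subseteq> gens n" if "m \<in> Poly_Mapping.keys (a * b)" for m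
    proof -
      from that obtain u v where m: "m = u + v" "u \<in> Poly_Mapping.keys a" "v \<in> Poly_Mapping.keys b"
        using keys_mult[of a b] by blast
      then have "set (letters u) \<subseteq> gens n" "set (letters v) \<subseteq> gens n"
        using \<open>a \<in> carrier ?R\<close> \<open>b \<in> carrier ?R\<close> by auto
      then show ?thesis using m(1) by simp
    qed
    then show ?thesis by simp
  qed
  show "abelian_group ?R"
  proof (rule abelian_groupI)
    fix x assume "x \<in> carrier ?R"
    then show "\<exists>y\<in>carrier ?R. y \<oplus>\<^bsub>?R\<^esub> x = \<zero>\<^bsub>?R\<^esub>"
      by (intro bexI[of _ "- x"]) auto
    fix y assume "y \<in> carrier ?R"
    with \<open>x \<in> carrier ?R\<close> show "x \<oplus>\<^bsub>?R\<^esub> y \<in> carrier ?R"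
      using add[of x y] by simp
  qed (auto simp: ac_simps)
  show "monoid ?R"
    by (rule monoidI; (simp only: free_alg_simps(2-5))?; (rule mul; assumption | simp add: mult.assoc))
qed (auto simp: distrib_left distrib_right)

lemma cring_comm_alg: "cring (comm_alg n :: ((gen \<Rightarrow>\<^sub>0 nat) \<Rightarrow>\<^sub>0 'a::field) ring)" (is "cring ?R")
proof (rule cringI)
  have add: "a + b \<in> carrier ?R" if "a \<in> carrier ?R" "b \<in> carrier ?R" for a b
    using that keys_add[of a b] by auto
  have mul: "a * b \<in> carrier ?R" if "a \<in> carrier ?R" "b \<in> carrier ?R" for a b
  proof -
    have "Poly_Mapping.keys m \<subseteq> gens n" if "m \<in> Poly_Mapping.keys (a * b)" for m
    proof -
      from that obtain u v where m: "m = u + v" "u \<in> Poly_Mapping.keys a" "v \<in> Poly_Mapping.keys b"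
        using keys_mult[of a b] by blast
      then have "Poly_Mapping.keys u \<subseteq> gens n" "Poly_Mapping.keys v \<subseteq> gens n"
        using \<open>a \<in> carrier ?R\<close> \<open>b \<in> carrier ?R\<close> by auto
      then show ?thesis using m(1) keys_add[of u v] by blast
    qed
    then show ?thesis by simp
  qed
  show "abelian_group ?R"
  proof (rule abelian_groupI)
    fix x assume "x \<in> carrier ?R"
    then show "\<exists>y\<in>carrier ?R. y \<oplus>\<^bsub>?R\<^esub> x = \<zero>\<^bsub>?R\<^esub>"
      by (intro bexI[of _ "- x"]) auto
    fix y assume "y \<in> carrier ?R"
    with \<open>x \<in> carrier ?R\<close> show "x \<oplus>\<^bsub>?R\<^esub> y \<in> carrier ?R"
      using add[of x y] by simp
  qed (auto simp: ac_simps)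
  show "comm_monoid ?R"
    by (rule comm_monoidI; (simp only: comm_alg_simps(2-5))?; (rule mul; assumption | simp add: ac_simps))
qed (auto simp: distrib_right)

lemma relators_subset: "relators n q \<subseteq> carrier (free_alg n)"
proof -
  interpret ring "free_alg n :: (gen word \<Rightarrow>\<^sub>0 'a) ring" by (rule ring_free_alg)
  have v: "var g \<in> carrier (free_alg n)" if "g \<in> gens n" for g and n
    using that by (auto simp: var_def)
  have s: "scalar q \<in> carrier (free_alg n)" for n by (auto simp: scalar_def)
  have m: "a * b \<in> carrier (free_alg n)" if "a \<in> carrier (free_alg n)" "b \<in> carrier (free_alg n)"
    for a b :: "gen word \<Rightarrow>\<^sub>0 'a"
    using m_closed[OF that] by (simp only: free_alg_simps(2))
  have d: "a - b \<in> carrier (free_alg n)" if "a \<in> carrier (free_alg n)" "b \<in> carrier (free_alg n)"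
    for a b :: "gen word \<Rightarrow>\<^sub>0 'a"
    using that keys_diff[of a b] by auto
  show ?thesis
    unfolding relators_def by (auto simp: gens_def simp del: free_alg_simps intro!: d m v s)
qed

lemma ideal_rel_ideal: "ideal (rel_ideal n q) (free_alg n)"
  unfolding rel_ideal_def by (rule ring.genideal_ideal[OF ring_free_alg relators_subset])

lemma ring_q_alg: "ring (q_alg n q)"
  unfolding q_alg_def by (rule ideal.quotient_is_ring[OF ideal_rel_ideal])


text \<open>Injectivity of \<open>of_comm\<close>: reordering a word costs a factor $q$ for each pair of a $y$
  standing before an $x$, and the resulting linear map kills the relations.\<close>

fun abel :: "gen list \<Rightarrow> gen \<Rightarrow>\<^sub>0 nat" where
  "abel [] = 0" | "abel (g # w) = Poly_Mapping.single g 1 + abel w"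

fun invs :: "gen list \<Rightarrow> nat" where
  "invs [] = 0" 
| "invs (XV i # w) = invs w"
| "invs (YV i # w) = length (filter (\<lambda>g. g \<in> range XV) w) + invs w"

lemma abel_append [simp]: "abel (u @ v) = abel u + abel v"
  by (induction u) (auto simp: algebra_simps)

lemma invs_append: "invs (u @ v) =
  invs u + invs v + length (filter (\<lambda>g. g \<in> range YV) u) * length (filter (\<lambda>g. g \<in> range XV) v)"
  by (induction u rule: invs.induct) (auto simp: algebra_simps)

definition psi :: "'k \<Rightarrow> (gen word \<Rightarrow>\<^sub>0 'k::field) \<Rightarrow> (gen \<Rightarrow>\<^sub>0 nat) \<Rightarrow>\<^sub>0 'k"
  where "psi q p = (\<Sum>w\<in>Poly_Mapping.keys p.
    Poly_Mapping.single (abel (letters w)) (Poly_Mapping.lookup p w * q ^ invs (letters w)))"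

lemma psi_add: "psi q (a + b) = psi q a + psi q b"
  unfolding psi_def
  by (rule setsum_keys_plus_distrib) (auto simp: algebra_simps single_add)

lemma psi_zero [simp]: "psi q 0 = 0" by (simp add: psi_def)

lemma psi_diff: "psi q (a - b) = psi q a - psi q b"
  using psi_add[of q "a - b" b] by simp

lemma psi_single: "psi q (Poly_Mapping.single w c) =
    Poly_Mapping.single (abel (letters w)) (c * q ^ invs (letters w))"
  by (simp add: psi_def)

lemma psi_sum: "psi q (sum f A) = (\<Sum>i\<in>A. psi q (f i))"
  by (induction A rule: infinite_finite_induct) (auto simp: psi_add)

lemma ordered_lift_add: "ordered_lift n (a + b) = ordered_lift n a + ordered_lift n b"
  unfolding ordered_lift_def
  by (rule setsum_keys_plus_distrib) (auto simp: algebra_simps single_add)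

lemma ordered_lift_zero [simp]: "ordered_lift n 0 = 0" by (simp add: ordered_lift_def)

lemma ordered_lift_diff: "ordered_lift n (a - b) = ordered_lift n a - ordered_lift n b"
  using ordered_lift_add[of n "a - b" b] by simp

lemma ordered_lift_single: "ordered_lift n (Poly_Mapping.single m c) = Poly_Mapping.single (ordered_word n m) c"
  by (simp add: ordered_lift_def)

lemma sum_single_lookup: "(\<Sum>k\<in>Poly_Mapping.keys f. Poly_Mapping.single k (Poly_Mapping.lookup f k)) = f"
  by (rule poly_mapping_eqI) (auto simp: lookup_sum lookup_single when_def in_keys_iff sum.delta)

lemma poly_mapping_add_induct [case_names zero single add]:
  assumes "P 0" "\<And>k c. P (Poly_Mapping.single k c)" "\<And>a b. P a \<Longrightarrow> P b \<Longrightarrow> P (a + b)"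
  shows "P (f :: 'a \<Rightarrow>\<^sub>0 'b::comm_monoid_add)"
proof -
  have "P (\<Sum>k\<in>A. Poly_Mapping.single k (Poly_Mapping.lookup f k))" for A
    by (induction A rule: infinite_finite_induct) (auto simp: assms)
  then show ?thesis by (metis sum_single_lookup)
qed

definition ker_ideal :: "nat \<Rightarrow> 'k \<Rightarrow> (gen word \<Rightarrow>\<^sub>0 'k::field) set"
  where "ker_ideal n q = {p \<in> carrier (free_alg n). \<forall>u v. psi q (u * p * v) = 0}"

lemma ideal_ker_ideal: "ideal (ker_ideal n q) (free_alg n :: (gen word \<Rightarrow>\<^sub>0 'a::field) ring)"
  (is "ideal ?K ?R")
proof -
  interpret ring ?R by (rule ring_free_alg)
  have kI: "p \<in> ?K" if "p \<in> carrier ?R" "\<And>u v. psi q (u * p * v) = 0" for p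
    using that unfolding ker_ideal_def by blast
  have kc: "p \<in> carrier ?R" if "p \<in> ?K" for p
    using that unfolding ker_ideal_def by blast
  have kp: "psi q (u * p * v) = 0" if "p \<in> ?K" for u p v
    using that unfolding ker_ideal_def by blast
  show ?thesis
  proof (rule idealI[OF ring_axioms])
    show "subgroup ?K (add_monoid ?R)"
    proof (rule add.subgroupI)
      show "?K \<subseteq> carrier ?R" using kc by blast
      have "0 \<in> ?K" by (rule kI) simp_all
      then show "?K \<noteq> {}" by blast
    next
      fix a assume a: "a \<in> ?K"
      have c: "- a \<in> carrier ?R" using kc[OF a] by simp
      moreover have "- a \<oplus>\<^bsub>?R\<^esub> a = \<zero>\<^bsub>?R\<^esub>" by simp
      ultimately have m: "\<ominus>\<^bsub>?R\<^esub> a = - a" using kc[OF a] by (intro minus_equality)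
      have "psi q (u * (- a) * v) = 0" for u v
        using psi_diff[of q 0 "u * a * v"] kp[OF a, of u v] by simp
      then show "\<ominus>\<^bsub>?R\<^esub> a \<in> ?K" unfolding m by (rule kI[OF c])
    next
      fix a b assume a: "a \<in> ?K" and b: "b \<in> ?K"
      show "a \<oplus>\<^bsub>?R\<^esub> b \<in> ?K"
      proof (rule kI)
        show "a \<oplus>\<^bsub>?R\<^esub> b \<in> carrier ?R" by (rule a_closed[OF kc[OF a] kc[OF b]])
        show "psi q (u * (a \<oplus>\<^bsub>?R\<^esub> b) * v) = 0" for u v
          by (simp only: free_alg_simps(5) distrib_left distrib_right psi_add kp[OF a] kp[OF b]) simp
      qed
    qed
  next
    fix a x assume a: "a \<in> ?K" and x: "x \<in> carrier ?R"
    show "x \<otimes>\<^bsub>?R\<^esub> a \<in> ?K"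
    proof (rule kI)
      show "x \<otimes>\<^bsub>?R\<^esub> a \<in> carrier ?R" by (rule m_closed[OF x kc[OF a]])
      show "psi q (u * (x \<otimes>\<^bsub>?R\<^esub> a) * v) = 0" for u v
        using kp[OF a, of "u * x" v] by (simp only: free_alg_simps(2) mult.assoc)
    qed
    show "a \<otimes>\<^bsub>?R\<^esub> x \<in> ?K"
    proof (rule kI)
      show "a \<otimes>\<^bsub>?R\<^esub> x \<in> carrier ?R" by (rule m_closed[OF kc[OF a] x])
      show "psi q (u * (a \<otimes>\<^bsub>?R\<^esub> x) * v) = 0" for u v
        using kp[OF a, of u "x * v"] by (simp only: free_alg_simps(2) mult.assoc)
    qed
  qed
qed

lemma psi_mid_zero:
  assumes "\<And>u v. psi q (Poly_Mapping.single u 1 * p * Poly_Mapping.single v 1) = 0"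
  shows "psi q (a * p * b) = 0"
proof -
  have sc: "psi q (scalar c * r) = Poly_Mapping.single 0 c * psi q r" for c r
    by (induction r rule: poly_mapping_add_induct)
      (auto simp: scalar_def mult_single psi_single psi_add distrib_left mult.assoc)
  have sc': "scalar c * r = r * scalar c" for c :: 'a and r
    by (induction r rule: poly_mapping_add_induct)
      (auto simp: scalar_def mult_single distrib_left distrib_right mult.commute)
  have sp: "Poly_Mapping.single u c = scalar c * Poly_Mapping.single u 1" for u and c :: 'a
    by (simp add: scalar_def mult_single)
  have 1: "psi q (a * p * Poly_Mapping.single v 1) = 0" for a v
  proof (induction a rule: poly_mapping_add_induct)
    case (single k c)
    have "Poly_Mapping.single k c * p * Poly_Mapping.single v 1
       = scalar c * (Poly_Mapping.single k 1 * p * Poly_Mapping.single v 1)"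
      by (subst sp) (simp add: mult.assoc)
    then show ?case by (simp add: sc assms)
  qed (auto simp: distrib_right psi_add)
  show ?thesis
  proof (induction b rule: poly_mapping_add_induct)
    case (single k c)
    have "a * p * Poly_Mapping.single k c = scalar c * (a * p * Poly_Mapping.single k 1)"
      by (subst sp, subst sc', subst sc') (simp add: mult.assoc)
    then show ?case by (simp add: sc 1)
  qed (auto simp: distrib_left psi_add)
qed

lemma rel_ideal_subset_ker: "rel_ideal n q \<subseteq> ker_ideal n q"
  unfolding rel_ideal_def
proof (rule ring.genideal_minimal[OF ring_free_alg ideal_ker_ideal])
  have d: "psi q (Poly_Mapping.single u 1 * (Poly_Mapping.single a c - Poly_Mapping.single b d)
      * Poly_Mapping.single v 1) = 0"
    if "psi q (Poly_Mapping.single (u + a + v) c) = psi q (Poly_Mapping.single (u + b + v) d)"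
    for u v a b c d
    using that by (simp add: mult_single right_diff_distrib left_diff_distrib psi_diff)
  have "psi q (Poly_Mapping.single u 1 * r * Poly_Mapping.single v 1) = 0"
    if r: "r \<in> relators n q" for r u v
  proof -
    from r consider i j where "r = var (XV i) * var (XV j) - var (XV j) * var (XV i)"
      | i j where "r = var (YV i) * var (YV j) - var (YV j) * var (YV i)"
      | i j where "r = var (YV i) * var (XV j) - scalar q * var (XV j) * var (YV i)"
      unfolding relators_def by blast
    then show ?thesis
      by cases (simp only: var_def scalar_def mult_single add_0 mult_1 mult_1_right, rule d,
        simp add: psi_single invs_append image_iff power_add ac_simps)+
  qed
  then have "p \<in> ker_ideal n q" if "p \<in> relators n q" for p
    using relators_subset[of n q] that unfolding ker_ideal_def by (blast intro: psi_mid_zero)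
  then show "relators n q \<subseteq> ker_ideal n q" by blast
qed

lemma abel_ordered_word:
  assumes "Poly_Mapping.keys m \<subseteq> gens n"
  shows "abel (letters (ordered_word n m)) = m"
proof -
  have rep: "abel (replicate k g) = Poly_Mapping.single g k" for k g
    by (induction k) (auto simp: single_add[symmetric])
  have *: "abel (concat (map (\<lambda>g. replicate (Poly_Mapping.lookup m g) g) xs)) =
     (\<Sum>g\<in>set xs. Poly_Mapping.single g (Poly_Mapping.lookup m g))" if "distinct xs" for xs
    using that by (induction xs) (auto simp: rep)
  have "set (map XV [0..<Suc n] @ map YV [0..<Suc n]) = gens n"
    by (auto simp: gens_def)
  then have "abel (letters (ordered_word n m)) = (\<Sum>g\<in>gens n. Poly_Mapping.single g (Poly_Mapping.lookup m g))"
    unfolding ordered_word_def by (subst (asm) eq_commute) (simp only: word.sel, subst *, auto simp: distinct_map inj_on_def)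
  also have "\<dots> = (\<Sum>g\<in>Poly_Mapping.keys m. Poly_Mapping.single g (Poly_Mapping.lookup m g))"
    by (rule sum.mono_neutral_right) (use assms in \<open>auto simp: gens_def in_keys_iff\<close>)
  also have "\<dots> = m" by (rule sum_single_lookup)
  finally show ?thesis .
qed

lemma invs_ordered_word: "invs (letters (ordered_word n m)) = 0"
proof -
  have x: "invs xs = 0" if "set xs \<subseteq> range XV" for xs
    using that by (induction xs rule: invs.induct) auto
  have y: "invs xs = 0" if "set xs \<subseteq> range YV" for xs
    using that by (induction xs rule: invs.induct) (auto simp: filter_empty_conv)
  have fx: "filter (\<lambda>g. g \<in> range YV) xs = []" if "set xs \<subseteq> range XV" for xs
    using that by (auto simp: filter_empty_conv)
  show ?thesis unfolding ordered_word_def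
    by (simp only: word.sel map_append concat_append invs_append)
      (subst x y fx; auto)+
qed

lemma set_ordered_word: "set (letters (ordered_word n m)) \<subseteq> gens n"
  by (auto simp: ordered_word_def gens_def)

lemma ordered_lift_closed: "ordered_lift n f \<in> carrier (free_alg n)"
proof -
  have "Poly_Mapping.keys (ordered_lift n f) \<subseteq> range (ordered_word n)"
    unfolding ordered_lift_def by (rule order.trans[OF keys_sum]) auto
  then show ?thesis using set_ordered_word by fastforce
qed

lemma psi_ordered_lift:
  assumes "f \<in> carrier (comm_alg n)"
  shows "psi q (ordered_lift n f) = f"
proof -
  have "psi q (ordered_lift n f) = (\<Sum>m\<in>Poly_Mapping.keys f. Poly_Mapping.single m (Poly_Mapping.lookup f m))"
    unfolding ordered_lift_def psi_sum psi_single invs_ordered_word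
    by (rule sum.cong) (use assms in \<open>auto simp: abel_ordered_word\<close>)
  then show ?thesis by (simp add: sum_single_lookup)
qed


lemma rel_ideal_closed:
  "p \<in> rel_ideal n q \<Longrightarrow> r \<in> rel_ideal n q \<Longrightarrow> p + r \<in> rel_ideal n q"
  "p \<in> rel_ideal n q \<Longrightarrow> a \<in> carrier (free_alg n) \<Longrightarrow> a * p \<in> rel_ideal n q"
  "p \<in> rel_ideal n q \<Longrightarrow> a \<in> carrier (free_alg n) \<Longrightarrow> p * a \<in> rel_ideal n q"
  "0 \<in> rel_ideal n q"
  for q :: "'a::field"
proof -
  interpret ideal "rel_ideal n q" "free_alg n" by (rule ideal_rel_ideal)
  show "p \<in> rel_ideal n q \<Longrightarrow> r \<in> rel_ideal n q \<Longrightarrow> p + r \<in> rel_ideal n q"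
    using additive_subgroup.a_closed[OF is_additive_subgroup, of p r] by (simp only: free_alg_simps(5))
  show "p \<in> rel_ideal n q \<Longrightarrow> a \<in> carrier (free_alg n) \<Longrightarrow> a * p \<in> rel_ideal n q"
    using I_l_closed[of p a] by (simp only: free_alg_simps(2))
  show "p \<in> rel_ideal n q \<Longrightarrow> a \<in> carrier (free_alg n) \<Longrightarrow> p * a \<in> rel_ideal n q"
    using I_r_closed[of p a] by (simp only: free_alg_simps(2))
  show "0 \<in> rel_ideal n q"
    using additive_subgroup.zero_closed[OF is_additive_subgroup] by (simp only: free_alg_simps(4))
qed

lemma rel_ideal_trans:
  "a - b \<in> rel_ideal n q \<Longrightarrow> b - c \<in> rel_ideal n q \<Longrightarrow> a - c \<in> rel_ideal n q"
  using rel_ideal_closed(1)[of "a - b" n q "b - c"] by simp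

lemma swap_letters:
  assumes "g \<in> gens n" "h \<in> gens n" "g \<in> range XV \<Longrightarrow> h \<in> range XV"
  shows "\<exists>s. Poly_Mapping.single (Word [g, h]) 1 - Poly_Mapping.single (Word [h, g]) s \<in> rel_ideal n q"
proof -
  have R: "r \<in> rel_ideal n q" if "r \<in> relators n q" for r
    using ring.genideal_self[OF ring_free_alg relators_subset] that unfolding rel_ideal_def by blast
  have v: "var a * var b = Poly_Mapping.single (Word [a, b]) 1"
    "scalar q * var a * var b = Poly_Mapping.single (Word [a, b]) q" for a b
    by (auto simp: var_def scalar_def mult_single plus_word_def)
  consider i j where "g = XV i" "h = XV j" "i \<le> n" "j \<le> n" | i j where "g = YV i" "h = YV j" "i \<le> n" "j \<le> n"
    | i j where "g = YV i" "h = XV j" "i \<le> n" "j \<le> n"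
    using assms unfolding gens_def by auto
  then show ?thesis
  proof cases
    case 1
    then have "var g * var h - var h * var g \<in> relators n q" unfolding relators_def by blast
    from R[OF this] show ?thesis unfolding v by blast
  next
    case 2
    then have "var g * var h - var h * var g \<in> relators n q" unfolding relators_def by blast
    from R[OF this] show ?thesis unfolding v by blast
  next
    case 3
    then have "var g * var h - scalar q * var h * var g \<in> relators n q" unfolding relators_def by blast
    from R[OF this] show ?thesis unfolding v by blast
  qed
qed

lemma move_letter:
  assumes "g \<in> gens n" "set l \<subseteq> gens n" "set r \<subseteq> gens n" "g \<in> range XV \<Longrightarrow> set l \<subseteq> range XV"
  shows "\<exists>d. Poly_Mapping.single (Word (g # l @ r)) c - Poly_Mapping.single (Word (l @ g # r)) d \<in> rel_ideal n q"
  using assms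
proof (induction l arbitrary: c)
  case Nil
  then show ?case using rel_ideal_closed(4)[of n q] by (intro exI[of _ c]) simp
next
  case (Cons h l)
  obtain s where s: "Poly_Mapping.single (Word [g, h]) 1 - Poly_Mapping.single (Word [h, g]) s \<in> rel_ideal n q"
    using swap_letters[of g n h q] Cons.prems by auto
  obtain d where d: "Poly_Mapping.single (Word (g # l @ r)) (s * c) - Poly_Mapping.single (Word (l @ g # r)) d \<in> rel_ideal n q"
    using Cons.IH[of "s * c"] Cons.prems by auto
  have "Poly_Mapping.single (Word (l @ r)) c \<in> carrier (free_alg n)"
    using Cons.prems by auto
  from rel_ideal_closed(3)[OF s this]
  have 1: "Poly_Mapping.single (Word (g # h # l @ r)) c - Poly_Mapping.single (Word (h # g # l @ r)) (s * c)
      \<in> rel_ideal n q"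
    by (simp add: left_diff_distrib mult_single plus_word_def)
  have "Poly_Mapping.single (Word [h]) 1 \<in> carrier (free_alg n)"
    using Cons.prems by auto
  from rel_ideal_closed(2)[OF d this]
  have 2: "Poly_Mapping.single (Word (h # g # l @ r)) (s * c) - Poly_Mapping.single (Word (h # l @ g # r)) d
      \<in> rel_ideal n q"
    by (simp add: right_diff_distrib mult_single plus_word_def)
  show ?case using rel_ideal_trans[OF 1 2] by auto
qed

lemma ordered_word_insert:
  assumes "g \<in> gens n"
  obtains l r where "letters (ordered_word n m) = l @ r"
    "letters (ordered_word n (m + Poly_Mapping.single g 1)) = l @ g # r"
    "g \<in> range XV \<Longrightarrow> set l \<subseteq> range XV"
proof -
  define b where "b m xs = concat (map (\<lambda>g. replicate (Poly_Mapping.lookup m g) g) xs)"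
    for m :: "gen \<Rightarrow>\<^sub>0 nat" and xs
  let ?L = "map XV [0..<Suc n] @ map YV [0..<Suc n]"
  have split: "\<exists>xs ys. ?L = xs @ g # ys \<and> (g \<in> range XV \<longrightarrow> set xs \<subseteq> range XV)"
  proof (cases g)
    case (XV i)
    then have "i \<in> set [0..<Suc n]" using assms by (auto simp: gens_def)
    then obtain us vs where "[0..<Suc n] = us @ i # vs" by (meson split_list)
    then have "?L = map XV us @ g # (map XV vs @ map YV [0..<Suc n])" using XV by simp
    moreover have "set (map XV us) \<subseteq> range XV" by auto
    ultimately show ?thesis by blast
  next
    case (YV i)
    then have "g \<in> set ?L" using assms by (auto simp: gens_def)
    then obtain xs ys where "?L = xs @ g # ys" by (meson split_list)
    then show ?thesis using YV by blast
  qed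
  then obtain xs ys where L: "?L = xs @ g # ys" and xs: "g \<in> range XV \<Longrightarrow> set xs \<subseteq> range XV" by blast
  have "distinct ?L" by (auto simp: distinct_map inj_on_def)
  then have g: "g \<notin> set xs" "g \<notin> set ys" unfolding L by auto
  have b_upd: "b (m + Poly_Mapping.single g 1) zs = b m zs" if "g \<notin> set zs" for zs
    unfolding b_def using that by (auto intro!: arg_cong[of _ _ concat] simp: lookup_add lookup_single when_def)
  have ow: "letters (ordered_word n m') = b m' xs @ replicate (Poly_Mapping.lookup m' g) g @ b m' ys" for m'
    unfolding ordered_word_def L b_def by simp
  show thesis
  proof (rule that)
    show "letters (ordered_word n m) = b m xs @ (replicate (Poly_Mapping.lookup m g) g @ b m ys)"
      by (rule ow)
    show "letters (ordered_word n (m + Poly_Mapping.single g 1)) =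
        b m xs @ g # (replicate (Poly_Mapping.lookup m g) g @ b m ys)"
      unfolding ow b_upd[OF g(1)] b_upd[OF g(2)] by (simp add: lookup_add)
    show "g \<in> range XV \<Longrightarrow> set (b m xs) \<subseteq> range XV"
      using xs unfolding b_def by auto
  qed
qed

lemma word_reduce:
  assumes "set w \<subseteq> gens n"
  shows "\<exists>m d. Poly_Mapping.keys m \<subseteq> gens n \<and>
    Poly_Mapping.single (Word w) c - Poly_Mapping.single (ordered_word n m) d \<in> rel_ideal n q"
  using assms
proof (induction w)
  case Nil
  have "letters (ordered_word n 0) = []" by (simp add: ordered_word_def)
  then have "ordered_word n 0 = Word []" by (metis word.collapse)
  then show ?case using rel_ideal_closed(4)[of n q] by (intro exI[of _ 0] exI[of _ c]) simp
next
  case (Cons g w)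
  then obtain m d where m: "Poly_Mapping.keys m \<subseteq> gens n"
    and d: "Poly_Mapping.single (Word w) c - Poly_Mapping.single (ordered_word n m) d \<in> rel_ideal n q"
    by auto
  from Cons.prems have g: "g \<in> gens n" by simp
  obtain l r where lr: "letters (ordered_word n m) = l @ r"
    "letters (ordered_word n (m + Poly_Mapping.single g 1)) = l @ g # r"
    "g \<in> range XV \<Longrightarrow> set l \<subseteq> range XV"
    by (rule ordered_word_insert[OF g, of m]) blast
  have w: "ordered_word n m = Word (l @ r)" "ordered_word n (m + Poly_Mapping.single g 1) = Word (l @ g # r)"
    using lr(1,2) by (metis word.collapse)+
  have "Poly_Mapping.single (Word [g]) 1 \<in> carrier (free_alg n)"
    using g by auto
  from rel_ideal_closed(2)[OF d this]
  have 1: "Poly_Mapping.single (Word (g # w)) c - Poly_Mapping.single (Word (g # l @ r)) d \<in> rel_ideal n q"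
    by (simp add: right_diff_distrib mult_single plus_word_def w)
  have "set l \<subseteq> gens n" "set r \<subseteq> gens n"
    using set_ordered_word[of n m] unfolding lr(1) by auto
  then obtain e where 2: "Poly_Mapping.single (Word (g # l @ r)) d - Poly_Mapping.single (Word (l @ g # r)) e
      \<in> rel_ideal n q"
    using move_letter[OF g _ _ lr(3), of r d q] by blast
  have "Poly_Mapping.keys (m + Poly_Mapping.single g 1) \<subseteq> gens n"
    using m g keys_add[of m "Poly_Mapping.single g 1"] by auto
  then show ?case using rel_ideal_trans[OF 1 2] unfolding w(2)[symmetric] by blast
qed

lemma free_alg_reduce:
  assumes "p \<in> carrier (free_alg n)"
  shows "\<exists>f\<in>carrier (comm_alg n). p - ordered_lift n f \<in> rel_ideal n q"
proof -
  have add: "a + b \<in> carrier (comm_alg n)" if "a \<in> carrier (comm_alg n)" "b \<in> carrier (comm_alg n)"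
    for a b :: "(gen \<Rightarrow>\<^sub>0 nat) \<Rightarrow>\<^sub>0 'a"
    using that keys_add[of a b] by auto
  have "\<exists>f\<in>carrier (comm_alg n). (\<Sum>w\<in>A. Poly_Mapping.single w (Poly_Mapping.lookup p w)) - ordered_lift n f
      \<in> rel_ideal n q" if "finite A" "A \<subseteq> Poly_Mapping.keys p" for A
    using that
  proof (induction A)
    case empty
    then show ?case using rel_ideal_closed(4)[of n q] by (intro bexI[of _ 0]) simp_all
  next
    case (insert w A)
    then obtain f where f: "f \<in> carrier (comm_alg n)"
      "(\<Sum>w\<in>A. Poly_Mapping.single w (Poly_Mapping.lookup p w)) - ordered_lift n f \<in> rel_ideal n q"
      by auto
    have "set (letters w) \<subseteq> gens n" using insert.prems assms by auto
    from word_reduce[OF this, of "Poly_Mapping.lookup p w" q]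
    obtain m d where m: "Poly_Mapping.keys m \<subseteq> gens n"
      "Poly_Mapping.single w (Poly_Mapping.lookup p w) - ordered_lift n (Poly_Mapping.single m d) \<in> rel_ideal n q"
      by (auto simp: ordered_lift_single)
    have "Poly_Mapping.single m d \<in> carrier (comm_alg n)" using m(1) by auto
    with f(1) have "Poly_Mapping.single m d + f \<in> carrier (comm_alg n)" by (intro add)
    moreover have "(\<Sum>w\<in>insert w A. Poly_Mapping.single w (Poly_Mapping.lookup p w))
        - ordered_lift n (Poly_Mapping.single m d + f) \<in> rel_ideal n q"
      using rel_ideal_closed(1)[OF m(2) f(2)] insert.hyps by (simp add: ordered_lift_add algebra_simps)
    ultimately show ?case by blast
  qed
  from this[of "Poly_Mapping.keys p"] show ?thesis by (simp only: sum_single_lookup finite_keys order_refl)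
qed

lemma rel_ideal_coset_eq:
  assumes "a \<in> carrier (free_alg n)" "b \<in> carrier (free_alg n)"
  shows "rel_ideal n q +>\<^bsub>free_alg n\<^esub> a = rel_ideal n q +>\<^bsub>free_alg n\<^esub> b \<longleftrightarrow> a - b \<in> rel_ideal n q"
proof -
  interpret ring "free_alg n :: (gen word \<Rightarrow>\<^sub>0 'a) ring" by (rule ring_free_alg)
  have "- b \<in> carrier (free_alg n)" using assms(2) by simp
  moreover have "- b \<oplus>\<^bsub>free_alg n\<^esub> b = \<zero>\<^bsub>free_alg n\<^esub>" by simp
  ultimately have "\<ominus>\<^bsub>free_alg n\<^esub> b = - b" using assms(2) by (intro minus_equality)
  then have "a \<ominus>\<^bsub>free_alg n\<^esub> b = a - b" unfolding a_minus_def by simp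
  then show ?thesis using quotient_eq_iff_same_a_r_cos[OF ideal_rel_ideal assms, of q] by simp
qed

lemma bij_betw_of_comm: "bij_betw (of_comm n q) (carrier (comm_alg n)) (carrier (q_alg n q))"
proof -
  interpret ring "free_alg n :: (gen word \<Rightarrow>\<^sub>0 'a) ring" by (rule ring_free_alg)
  have car: "carrier (q_alg n q) = (\<lambda>p. rel_ideal n q +>\<^bsub>free_alg n\<^esub> p) ` carrier (free_alg n)"
    unfolding q_alg_def FactRing_def A_RCOSETS_def' by auto
  show ?thesis
  proof (rule bij_betwI')
    fix f g assume fg: "f \<in> carrier (comm_alg n :: ((gen \<Rightarrow>\<^sub>0 nat) \<Rightarrow>\<^sub>0 'a) ring)" "g \<in> carrier (comm_alg n :: ((gen \<Rightarrow>\<^sub>0 nat) \<Rightarrow>\<^sub>0 'a) ring)"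
    show "of_comm n q f = of_comm n q g \<longleftrightarrow> f = g"
    proof
      assume "of_comm n q f = of_comm n q g"
      then have "ordered_lift n f - ordered_lift n g \<in> rel_ideal n q"
        unfolding of_comm_def rel_ideal_coset_eq[OF ordered_lift_closed ordered_lift_closed] .
      then have "ordered_lift n f - ordered_lift n g \<in> ker_ideal n q" using rel_ideal_subset_ker by blast
      then have "psi q (1 * (ordered_lift n f - ordered_lift n g) * 1) = 0" unfolding ker_ideal_def by blast
      then show "f = g" by (simp add: psi_diff psi_ordered_lift[OF fg(1)] psi_ordered_lift[OF fg(2)])
    qed simp
  next
    fix f :: "(gen \<Rightarrow>\<^sub>0 nat) \<Rightarrow>\<^sub>0 'a"
    show "of_comm n q f \<in> carrier (q_alg n q)"
      unfolding of_comm_def car by (rule imageI[OF ordered_lift_closed])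
  next
    fix A assume "A \<in> carrier (q_alg n q)"
    then obtain p where p: "p \<in> carrier (free_alg n)" "A = rel_ideal n q +>\<^bsub>free_alg n\<^esub> p"
      unfolding car by blast
    then show "\<exists>f\<in>carrier (comm_alg n). A = of_comm n q f"
      unfolding of_comm_def using free_alg_reduce[OF p(1), of q] rel_ideal_coset_eq[OF p(1) ordered_lift_closed]
      by blast
  qed
qed

end

theory Submission
  imports Defs
begin

text \<open>
  Carry the product of the quotient algebra over to the commutative polynomials: this is
  \<open>qprod\<close>. Moving a block of \<open>y\<close>s past a block of \<open>x\<close>s costs one factor \<open>q\<close> for each pair,
  so on monomials \<open>qprod\<close> is the commutative product multiplied by a power of \<open>q\<close> whose
  exponent is the \<open>y\<close>-degree of the left factor times the \<open>x\<close>-degree of the right one. Two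
  consequences carry the proof.

  First, multiplication by \<open>x\<close> on the right agrees with multiplication by \<open>x\<close> on the left
  after every monomial \<open>m\<close> is rescaled by \<open>q ^ ydeg n m\<close>. A completely prime ideal that does
  not contain \<open>x\<close> is therefore stable under this rescaling (\<open>I_twist\<close>), and symmetrically
  with \<open>y\<close> and the \<open>x\<close>-degree. Since \<open>q\<close> is not a root of unity, the eigenvalues of the
  rescaling separate the degrees; subtracting a multiple of the original element kills the
  monomials of one degree and keeps those of the others. After finitely many such steps only one
  bi-degree is left, so the ideal contains a nonzero bi-homogeneous element
  (\<open>exists_bihomogeneous\<close>). If the ideal does contain \<open>x\<close> or \<open>y\<close>, there is nothing to do.

  Second, on bi-homogeneous elements \<open>qprod\<close> and the commutative product agree up to one nonzero
  scalar (\<open>bihomogeneous_qprod\<close>), so for these the ideal is prime with respect to commutative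
  multiplication too. Commutative factors of a bi-homogeneous polynomial are bi-homogeneous
  (\<open>bihomogeneous_factor\<close>). Hence if a bi-homogeneous element of the ideal is reducible, one of
  its two factors lies in the ideal and has smaller total degree, and the descent ends at an
  irreducible element (\<open>exists_irreducible\<close>).
\<close>

section \<open>Rescaling monomials\<close>

definition scale :: "('a \<Rightarrow> 'b) \<Rightarrow> ('a \<Rightarrow>\<^sub>0 'b::semiring_0) \<Rightarrow> 'a \<Rightarrow>\<^sub>0 'b"
  where "scale a f = Poly_Mapping.mapp (\<lambda>m c. a m * c) f"

lemma lookup_scale [simp]: "Poly_Mapping.lookup (scale a f) m = a m * Poly_Mapping.lookup f m"
  by (simp add: scale_def lookup_mapp when_def in_keys_iff)

lemma keys_scale_subset: "Poly_Mapping.keys (scale a f) \<subseteq> Poly_Mapping.keys f"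
  by (auto simp: in_keys_iff)

lemma scale_one [simp]: "scale (\<lambda>_. 1) f = (f :: 'a \<Rightarrow>\<^sub>0 'b::semiring_1)"
  by (rule poly_mapping_eqI) simp

lemma times_expand:
  fixes f g :: "'a::monoid_add \<Rightarrow>\<^sub>0 'b::semiring_0"
  shows "f * g = (\<Sum>m\<in>Poly_Mapping.keys f. \<Sum>m'\<in>Poly_Mapping.keys g.
    Poly_Mapping.single (m + m') (Poly_Mapping.lookup f m * Poly_Mapping.lookup g m'))"
proof -
  have "f * g = (\<Sum>m\<in>Poly_Mapping.keys f. Poly_Mapping.single m (Poly_Mapping.lookup f m)) *
      (\<Sum>m\<in>Poly_Mapping.keys g. Poly_Mapping.single m (Poly_Mapping.lookup g m))"
    by (simp only: sum_single_lookup)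
  then show ?thesis by (simp only: sum_product mult_single)
qed

lemma nonzero_has_key: "f \<noteq> 0 \<Longrightarrow> \<exists>m. m \<in> Poly_Mapping.keys f"
  by (metis all_not_in_conv keys_eq_empty)

text \<open>Summing over the keys of the unscaled factors allows \<open>a\<close> and \<open>b\<close> to vanish, and lets the
  right-hand side be compared with the expansion of another product term by term.\<close>

lemma scale_times_expand:
  fixes f g :: "'a::monoid_add \<Rightarrow>\<^sub>0 'b::comm_semiring_0"
  shows "scale a f * scale b g = (\<Sum>m\<in>Poly_Mapping.keys f. \<Sum>m'\<in>Poly_Mapping.keys g.
    Poly_Mapping.single (m + m')
      (a m * b m' * (Poly_Mapping.lookup f m * Poly_Mapping.lookup g m')))"
proof -
  have s: "scale a f =
      (\<Sum>m\<in>Poly_Mapping.keys f. Poly_Mapping.single m (a m * Poly_Mapping.lookup f m))"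
    for a :: "'a \<Rightarrow> 'b" and f
    by (rule poly_mapping_eqI) (auto simp: lookup_sum lookup_single when_def in_keys_iff sum.delta)
  show ?thesis
    unfolding s sum_product mult_single by (simp only: ac_simps)
qed

lemma scale_const:
  fixes f :: "'a::monoid_add \<Rightarrow>\<^sub>0 'b::comm_semiring_1"
  shows "scale (\<lambda>_. c) f = Poly_Mapping.single 0 c * f"
proof -
  have "scale (\<lambda>_. 1) (Poly_Mapping.single 0 1) * scale (\<lambda>_. c) f = Poly_Mapping.single 0 c * f"
    by (subst scale_times_expand, subst times_expand) (cases "c = 0"; simp)
  then show ?thesis by simp
qed

section \<open>Factors of polynomials homogeneous for a weight\<close>

primrec gen_rank :: "gen \<Rightarrow> nat" where
  "gen_rank (XV i) = 2 * i"
| "gen_rank (YV i) = Suc (2 * i)"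

lemma gen_rank_inject: "gen_rank g = gen_rank h \<Longrightarrow> g = h"
  by (cases g; cases h; simp; presburger)

text \<open>Any linear order on the indeterminates will do: it orders the exponent vectors compatibly
  with addition, which is what makes the commutative polynomials an integral domain.\<close>

instantiation gen :: linorder
begin

definition less_eq_gen :: "gen \<Rightarrow> gen \<Rightarrow> bool"
  where "g \<le> h \<longleftrightarrow> gen_rank g \<le> gen_rank h"

definition less_gen :: "gen \<Rightarrow> gen \<Rightarrow> bool"
  where "g < h \<longleftrightarrow> gen_rank g < gen_rank h"

instance
  by standard (auto simp: less_eq_gen_def less_gen_def intro: gen_rank_inject)

end

text \<open>The parts of maximal weight multiply to something nonzero because there are no zero
  divisors, and nothing else in the product reaches the same weight. Integer weights make the
  statement applicable to minimal weights as well, by negating \<open>\<phi>\<close>.\<close>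

lemma exists_key_max_weight:
  fixes f g :: "'a::{ordered_cancel_comm_monoid_add, linorder} \<Rightarrow>\<^sub>0 'b::ring_no_zero_divisors"
    and \<phi> :: "'a \<Rightarrow> int"
  assumes \<phi>: "\<And>m m'. \<phi> (m + m') = \<phi> m + \<phi> m'"
    and f: "m\<^sub>f \<in> Poly_Mapping.keys f" "\<And>m. m \<in> Poly_Mapping.keys f \<Longrightarrow> \<phi> m \<le> \<phi> m\<^sub>f"
    and g: "m\<^sub>g \<in> Poly_Mapping.keys g" "\<And>m. m \<in> Poly_Mapping.keys g \<Longrightarrow> \<phi> m \<le> \<phi> m\<^sub>g"
  shows "\<exists>m\<in>Poly_Mapping.keys (f * g). \<phi> m = \<phi> m\<^sub>f + \<phi> m\<^sub>g"
proof -
  define top where "top d p = Poly_Mapping.mapp (\<lambda>m c. if \<phi> m = d then c else 0) p"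
    for d and p :: "'a \<Rightarrow>\<^sub>0 'b"
  have lt: "Poly_Mapping.lookup (top d p) m = (if \<phi> m = d then Poly_Mapping.lookup p m else 0)" for d p m
    by (simp add: top_def lookup_mapp when_def in_keys_iff)
  let ?f = "top (\<phi> m\<^sub>f) f" and ?g = "top (\<phi> m\<^sub>g) g"
  have "?f \<noteq> 0" "?g \<noteq> 0"
    using f(1) g(1) lt by (metis in_keys_iff lookup_zero)+
  then have "?f * ?g \<noteq> 0" by simp
  then obtain m where m: "m \<in> Poly_Mapping.keys (?f * ?g)" using nonzero_has_key by blast
  have wf: "\<phi> k = \<phi> m\<^sub>f" if "k \<in> Poly_Mapping.keys ?f" for k
    using that by (auto simp: in_keys_iff lt split: if_splits)
  have wg: "\<phi> k = \<phi> m\<^sub>g" if "k \<in> Poly_Mapping.keys ?g" for k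
    using that by (auto simp: in_keys_iff lt split: if_splits)
  have wf': "\<phi> k < \<phi> m\<^sub>f" if "k \<in> Poly_Mapping.keys (f - ?f)" for k
    using that f(2)[of k] by (auto simp: in_keys_iff lt lookup_minus order.order_iff_strict split: if_splits)
  have wg': "\<phi> k < \<phi> m\<^sub>g" if "k \<in> Poly_Mapping.keys (g - ?g)" for k
    using that g(2)[of k] by (auto simp: in_keys_iff lt lookup_minus order.order_iff_strict split: if_splits)
  have wm: "\<phi> m = \<phi> m\<^sub>f + \<phi> m\<^sub>g"
  proof -
    obtain k l where kl: "m = k + l" "k \<in> Poly_Mapping.keys ?f" "l \<in> Poly_Mapping.keys ?g"
      using m keys_mult[of ?f ?g] by blast
    then show ?thesis using wf[OF kl(2)] wg[OF kl(3)] \<phi>[of k l] unfolding kl(1) by linarith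
  qed
  have "m \<notin> Poly_Mapping.keys ((f - ?f) * g)"
  proof
    assume "m \<in> Poly_Mapping.keys ((f - ?f) * g)"
    then obtain k l where kl: "m = k + l" "k \<in> Poly_Mapping.keys (f - ?f)" "l \<in> Poly_Mapping.keys g"
      using keys_mult[of "f - ?f" g] by blast
    then show False using wf'[OF kl(2)] g(2)[OF kl(3)] wm \<phi>[of k l] unfolding kl(1) by linarith
  qed
  moreover have "m \<notin> Poly_Mapping.keys (?f * (g - ?g))"
  proof
    assume "m \<in> Poly_Mapping.keys (?f * (g - ?g))"
    then obtain k l where kl: "m = k + l" "k \<in> Poly_Mapping.keys ?f" "l \<in> Poly_Mapping.keys (g - ?g)"
      using keys_mult[of ?f "g - ?g"] by blast
    then show False using wf[OF kl(2)] wg'[OF kl(3)] wm \<phi>[of k l] unfolding kl(1) by linarith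
  qed
  moreover have "f * g = (f - ?f) * g + ?f * (g - ?g) + ?f * ?g"
    by (simp add: algebra_simps)
  ultimately have "m \<in> Poly_Mapping.keys (f * g)"
    using m by (simp add: in_keys_iff lookup_add)
  with wm show ?thesis by blast
qed

text \<open>The highest weights of the factors add up to a weight of the product, and so do the lowest.
  If the product has only one weight, both sums agree, which forces highest and lowest to coincide
  in each factor.\<close>

lemma factors_weight_homogeneous:
  fixes f g :: "'a::{ordered_cancel_comm_monoid_add, linorder} \<Rightarrow>\<^sub>0 'b::ring_no_zero_divisors"
    and \<phi> :: "'a \<Rightarrow> nat"
  assumes \<phi>: "\<And>m m'. \<phi> (m + m') = \<phi> m + \<phi> m'"
    and hom: "\<And>m. m \<in> Poly_Mapping.keys (f * g) \<Longrightarrow> \<phi> m = d"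
    and f: "m\<^sub>1 \<in> Poly_Mapping.keys f" "m\<^sub>2 \<in> Poly_Mapping.keys f"
    and g: "k \<in> Poly_Mapping.keys g"
  shows "\<phi> m\<^sub>1 = \<phi> m\<^sub>2"
proof -
  have max: "\<exists>m\<in>Poly_Mapping.keys p. \<forall>m'\<in>Poly_Mapping.keys p. \<psi> m' \<le> \<psi> m"
    if "Poly_Mapping.keys p \<noteq> {}" for p :: "'a \<Rightarrow>\<^sub>0 'b" and \<psi> :: "'a \<Rightarrow> int"
  proof -
    have "Max (\<psi> ` Poly_Mapping.keys p) \<in> \<psi> ` Poly_Mapping.keys p"
      using that by (intro Max_in) auto
    then obtain m where "m \<in> Poly_Mapping.keys p" "\<psi> m = Max (\<psi> ` Poly_Mapping.keys p)" by auto
    then show ?thesis using Max_ge[of "\<psi> ` Poly_Mapping.keys p"] by (metis finite_imageI finite_keys imageI)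
  qed
  define up dn where "up = (\<lambda>m. int (\<phi> m))" and "dn = (\<lambda>m. - int (\<phi> m))"
  obtain a a' b b' where
    a: "a \<in> Poly_Mapping.keys f" "\<forall>m\<in>Poly_Mapping.keys f. up m \<le> up a" and
    b: "b \<in> Poly_Mapping.keys f" "\<forall>m\<in>Poly_Mapping.keys f. dn m \<le> dn b" and
    a': "a' \<in> Poly_Mapping.keys g" "\<forall>m\<in>Poly_Mapping.keys g. up m \<le> up a'" and
    b': "b' \<in> Poly_Mapping.keys g" "\<forall>m\<in>Poly_Mapping.keys g. dn m \<le> dn b'"
    using max[of f up] max[of f dn] max[of g up] max[of g dn] f(1) g by blast
  have "\<exists>m\<in>Poly_Mapping.keys (f * g). up m = up a + up a'"
    by (rule exists_key_max_weight) (use a a' \<phi> in \<open>auto simp: up_def\<close>)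
  moreover have "\<exists>m\<in>Poly_Mapping.keys (f * g). dn m = dn b + dn b'"
    by (rule exists_key_max_weight) (use b b' \<phi> in \<open>auto simp: dn_def\<close>)
  ultimately have "\<phi> a + \<phi> a' = \<phi> b + \<phi> b'"
    using hom unfolding up_def dn_def by force
  moreover have "\<phi> b \<le> \<phi> a" "\<phi> b' \<le> \<phi> a'" using a(2) a'(2) b(1) b'(1) by (auto simp: up_def)
  ultimately have "\<phi> a = \<phi> b" by linarith
  moreover have "\<phi> m \<le> \<phi> a" "\<phi> b \<le> \<phi> m" if "m \<in> Poly_Mapping.keys f" for m
    using a(2) b(2) that by (auto simp: up_def dn_def)
  ultimately show ?thesis using f by (metis order.antisym)
qed

section \<open>Bi-degrees\<close>

definition xdeg :: "nat \<Rightarrow> (gen \<Rightarrow>\<^sub>0 nat) \<Rightarrow> nat"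
  where "xdeg n m = (\<Sum>i\<le>n. Poly_Mapping.lookup m (XV i))"

definition ydeg :: "nat \<Rightarrow> (gen \<Rightarrow>\<^sub>0 nat) \<Rightarrow> nat"
  where "ydeg n m = (\<Sum>i\<le>n. Poly_Mapping.lookup m (YV i))"

lemma bidegree_eq: "bidegree n m = (xdeg n m, ydeg n m)"
  by (simp add: bidegree_def xdeg_def ydeg_def)

lemma deg_add: "xdeg n (m + m') = xdeg n m + xdeg n m'" "ydeg n (m + m') = ydeg n m + ydeg n m'"
  by (simp_all add: xdeg_def ydeg_def lookup_add sum.distrib)

lemma deg_zero [simp]: "xdeg n 0 = 0" "ydeg n 0 = 0"
  by (simp_all add: xdeg_def ydeg_def)

lemma deg_var [simp]: "xdeg n (Poly_Mapping.single (YV i) c) = 0" "ydeg n (Poly_Mapping.single (XV i) c) = 0"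
  by (simp_all add: xdeg_def ydeg_def lookup_single)

lemma deg_eq_zero:
  assumes "Poly_Mapping.keys m \<subseteq> gens n" "xdeg n m = 0" "ydeg n m = 0"
  shows "m = 0"
proof (rule poly_mapping_eqI)
  fix g
  have "Poly_Mapping.lookup m g = 0" if "g \<in> gens n"
    using that assms(2,3) by (auto simp: xdeg_def ydeg_def gens_def)
  then show "Poly_Mapping.lookup m g = Poly_Mapping.lookup 0 g"
    using assms(1) by (auto simp: in_keys_iff)
qed

lemma bihomogeneousI:
  assumes "\<And>m m'. m \<in> Poly_Mapping.keys f \<Longrightarrow> m' \<in> Poly_Mapping.keys f \<Longrightarrow>
    xdeg n m = xdeg n m' \<and> ydeg n m = ydeg n m'"
  shows "bihomogeneous n f"
proof (cases "Poly_Mapping.keys f = {}")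
  case False
  then obtain m where "m \<in> Poly_Mapping.keys f" by blast
  then show ?thesis using assms[of _ m] unfolding bihomogeneous_def bidegree_eq by blast
qed (auto simp: bihomogeneous_def)

lemma bihomogeneousD:
  assumes "bihomogeneous n f" "m \<in> Poly_Mapping.keys f" "m' \<in> Poly_Mapping.keys f"
  shows "xdeg n m = xdeg n m'" "ydeg n m = ydeg n m'"
  using assms unfolding bihomogeneous_def bidegree_eq by (metis prod.inject)+

lemma bihomogeneous_factor:
  fixes f g :: "(gen \<Rightarrow>\<^sub>0 nat) \<Rightarrow>\<^sub>0 'k::field"
  assumes "bihomogeneous n (f * g)" "f * g \<noteq> 0"
  shows "bihomogeneous n f" "bihomogeneous n g"
proof -
  have main: "bihomogeneous n f" if hom: "bihomogeneous n (f * g)" and nz: "f * g \<noteq> 0"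
    for f g :: "(gen \<Rightarrow>\<^sub>0 nat) \<Rightarrow>\<^sub>0 'k"
  proof (rule bihomogeneousI)
    fix m m' assume m: "m \<in> Poly_Mapping.keys f" "m' \<in> Poly_Mapping.keys f"
    from nz have "g \<noteq> 0" by auto
    then obtain k where k: "k \<in> Poly_Mapping.keys g" using nonzero_has_key by blast
    obtain l where l: "l \<in> Poly_Mapping.keys (f * g)" using nonzero_has_key[OF nz] by blast
    have "xdeg n m = xdeg n m'"
      by (rule factors_weight_homogeneous[where \<phi> = "xdeg n", OF deg_add(1) bihomogeneousD(1)[OF hom _ l] m k])
    moreover have "ydeg n m = ydeg n m'"
      by (rule factors_weight_homogeneous[where \<phi> = "ydeg n", OF deg_add(2) bihomogeneousD(2)[OF hom _ l] m k])
    ultimately show "xdeg n m = xdeg n m' \<and> ydeg n m = ydeg n m'" ..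
  qed
  show "bihomogeneous n f" using main assms .
  show "bihomogeneous n g" using main[of g f] assms by (simp add: mult.commute)
qed

section \<open>The product of the quotient algebra on commutative polynomials\<close>

definition qprod :: "nat \<Rightarrow> 'k \<Rightarrow> ((gen \<Rightarrow>\<^sub>0 nat) \<Rightarrow>\<^sub>0 'k::field) \<Rightarrow>
    ((gen \<Rightarrow>\<^sub>0 nat) \<Rightarrow>\<^sub>0 'k) \<Rightarrow> (gen \<Rightarrow>\<^sub>0 nat) \<Rightarrow>\<^sub>0 'k"
  where "qprod n q f g = psi q (ordered_lift n f * ordered_lift n g)"

lemma count_generators_ordered_word:
  "length (filter (\<lambda>g. g \<in> range XV) (letters (ordered_word n m))) = xdeg n m"
  "length (filter (\<lambda>g. g \<in> range YV) (letters (ordered_word n m))) = ydeg n m"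
proof -
  have *: "length (filter Q (concat (map (\<lambda>g. replicate (h g) g) xs))) = sum_list (map h (filter Q xs))"
    for Q and h :: "gen \<Rightarrow> nat" and xs
    by (induction xs) (auto simp: filter_replicate)
  have l: "sum_list (map h [0..<Suc n]) = (\<Sum>i\<le>n. h i)" for h :: "nat \<Rightarrow> nat"
    by (simp only: interv_sum_list_conv_sum_set_nat set_upt atLeast0LessThan lessThan_Suc_atMost)
  have "filter (\<lambda>g. g \<in> range XV) (map XV [0..<Suc n] @ map YV [0..<Suc n]) = map XV [0..<Suc n]"
    "filter (\<lambda>g. g \<in> range YV) (map XV [0..<Suc n] @ map YV [0..<Suc n]) = map YV [0..<Suc n]"
    by (auto simp: filter_map o_def image_iff simp del: upt_Suc)
  then show "length (filter (\<lambda>g. g \<in> range XV) (letters (ordered_word n m))) = xdeg n m"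
    "length (filter (\<lambda>g. g \<in> range YV) (letters (ordered_word n m))) = ydeg n m"
    unfolding ordered_word_def word.sel * xdeg_def ydeg_def
    by (simp_all only: map_map o_def l)
qed

text \<open>Concatenating two ordered words creates inversions only between a \<open>y\<close> of the first and an
  \<open>x\<close> of the second.\<close>

lemma qprod_expand:
  assumes "f \<in> carrier (comm_alg n)" "g \<in> carrier (comm_alg n)"
  shows "qprod n q f g = (\<Sum>m\<in>Poly_Mapping.keys f. \<Sum>m'\<in>Poly_Mapping.keys g.
    Poly_Mapping.single (m + m') (q ^ (ydeg n m * xdeg n m') *
      (Poly_Mapping.lookup f m * Poly_Mapping.lookup g m')))"
  unfolding qprod_def ordered_lift_def sum_product mult_single psi_sum psi_single
  by (intro sum.cong refl)
    (use assms in \<open>auto simp: abel_ordered_word invs_append invs_ordered_word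
      count_generators_ordered_word ac_simps\<close>)

text \<open>Whenever the power of \<open>q\<close> splits into a part depending on the left monomial and one
  depending on the right monomial, \<open>qprod\<close> becomes a commutative product of rescaled factors.
  This happens if one factor is a constant or a single indeterminate, or if both factors are
  bi-homogeneous.\<close>

lemma qprod_eq_scaled_times:
  assumes "f \<in> carrier (comm_alg n)" "g \<in> carrier (comm_alg n)"
    and "\<And>m m'. m \<in> Poly_Mapping.keys f \<Longrightarrow> m' \<in> Poly_Mapping.keys g \<Longrightarrow>
      q ^ (ydeg n m * xdeg n m') = a m * b m'"
  shows "qprod n q f g = scale a f * scale b g"
  unfolding qprod_expand[OF assms(1,2)] scale_times_expand
  by (intro sum.cong refl) (simp add: assms(3))

text \<open>The product of two ordered representatives is congruent to some ordered representative, and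
  \<open>psi\<close>, which vanishes on the relations, recovers the latter from the former.\<close>

lemma of_comm_mult:
  assumes "f \<in> carrier (comm_alg n)" "g \<in> carrier (comm_alg n)"
  shows "of_comm n q f \<otimes>\<^bsub>q_alg n q\<^esub> of_comm n q g = of_comm n q (qprod n q f g)"
proof -
  interpret I: ideal "rel_ideal n q" "free_alg n :: (gen word \<Rightarrow>\<^sub>0 'a) ring" by (rule ideal_rel_ideal)
  let ?p = "ordered_lift n f * ordered_lift n g"
  have p: "?p \<in> carrier (free_alg n)"
    using I.m_closed[OF ordered_lift_closed ordered_lift_closed] by (simp only: free_alg_simps(2))
  obtain h where h: "h \<in> carrier (comm_alg n)" "?p - ordered_lift n h \<in> rel_ideal n q"
    using free_alg_reduce[OF p] by blast
  then have "?p - ordered_lift n h \<in> ker_ideal n q" using rel_ideal_subset_ker by blast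
  then have "psi q (1 * (?p - ordered_lift n h) * 1) = 0" unfolding ker_ideal_def by blast
  then have hq: "h = qprod n q f g" by (simp add: psi_diff psi_ordered_lift[OF h(1)] qprod_def)
  have "of_comm n q f \<otimes>\<^bsub>q_alg n q\<^esub> of_comm n q g = rel_ideal n q +>\<^bsub>free_alg n\<^esub> ?p"
    using I.rcoset_mult_add[OF ordered_lift_closed ordered_lift_closed, of f g]
    by (simp add: q_alg_def FactRing_def of_comm_def)
  also have "\<dots> = of_comm n q h"
    unfolding of_comm_def rel_ideal_coset_eq[OF p ordered_lift_closed] by (rule h(2))
  finally show ?thesis unfolding hq .
qed

lemma of_comm_add: "of_comm n q f \<oplus>\<^bsub>q_alg n q\<^esub> of_comm n q g = of_comm n q (f + g)"
proof -
  interpret I: ideal "rel_ideal n q" "free_alg n :: (gen word \<Rightarrow>\<^sub>0 'a) ring" by (rule ideal_rel_ideal)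
  show ?thesis
    using I.a_rcos_sum[OF ordered_lift_closed ordered_lift_closed, of f g]
    by (simp add: q_alg_def FactRing_def of_comm_def ordered_lift_add)
qed

lemma of_comm_closed: "f \<in> carrier (comm_alg n) \<Longrightarrow> of_comm n q f \<in> carrier (q_alg n q)"
  using bij_betw_of_comm by (rule bij_betw_apply)

lemma of_comm_zero: "of_comm n q 0 = \<zero>\<^bsub>q_alg n q\<^esub>"
proof -
  interpret ring "q_alg n q" by (rule ring_q_alg)
  have "of_comm n q 0 \<in> carrier (q_alg n q)" by (rule of_comm_closed) simp
  then show ?thesis using of_comm_add[of n q 0 0] by simp
qed

lemma to_comm_of_comm: "f \<in> carrier (comm_alg n) \<Longrightarrow> to_comm n q (of_comm n q f) = f"
  unfolding to_comm_def using bij_betw_of_comm by (rule bij_betw_inv_into_left)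

lemma comm_alg_scale_closed: "f \<in> carrier (comm_alg n) \<Longrightarrow> scale a f \<in> carrier (comm_alg n)"
  using keys_scale_subset[of a f] by auto

lemma comm_alg_const_closed: "Poly_Mapping.single 0 c \<in> carrier (comm_alg n)"
  by simp

section \<open>Completely prime ideals\<close>

locale generic_completely_prime =
  fixes n :: nat and q :: "'k::field" and P :: "(gen word \<Rightarrow>\<^sub>0 'k) set set"
  assumes q_nonzero: "q \<noteq> 0"
    and q_not_root: "\<forall>m::nat. m > 0 \<longrightarrow> q ^ m \<noteq> 1"
    and prime: "completely_prime P (q_alg n q)"
begin

abbreviation A :: "((gen \<Rightarrow>\<^sub>0 nat) \<Rightarrow>\<^sub>0 'k) set" where "A \<equiv> carrier (comm_alg n)"

text \<open>Passing to the preimage of \<open>P\<close> turns statements about cosets into statements about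
  polynomials: \<open>I\<close> is a completely prime ideal for the product \<open>qprod\<close>.\<close>

definition I :: "((gen \<Rightarrow>\<^sub>0 nat) \<Rightarrow>\<^sub>0 'k) set" where "I = {f \<in> A. of_comm n q f \<in> P}"

lemma I_carrier: "f \<in> I \<Longrightarrow> f \<in> A"
  unfolding I_def by blast

lemma ideal_P: "ideal P (q_alg n q)"
  using prime unfolding completely_prime_def by blast

lemma qprod_closed: "f \<in> A \<Longrightarrow> g \<in> A \<Longrightarrow> qprod n q f g \<in> A"
proof -
  assume f: "f \<in> A" and g: "g \<in> A"
  have "Poly_Mapping.keys (qprod n q f g) \<subseteq>
      {m + m' |m m'. m \<in> Poly_Mapping.keys f \<and> m' \<in> Poly_Mapping.keys g}"
    unfolding qprod_expand[OF f g]
    by (intro order.trans[OF keys_sum] UN_least) (auto split: if_splits)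
  moreover have "Poly_Mapping.keys (m + m') \<subseteq> gens n"
    if "m \<in> Poly_Mapping.keys f" "m' \<in> Poly_Mapping.keys g" for m m'
    using that f g keys_add[of m m'] by fastforce
  ultimately show ?thesis by auto
qed

lemma I_qprod_right:
  assumes "f \<in> I" "g \<in> A"
  shows "qprod n q f g \<in> I"
proof -
  interpret ideal P "q_alg n q" by (rule ideal_P)
  show ?thesis
    using I_r_closed[of "of_comm n q f" "of_comm n q g"] assms of_comm_closed[OF assms(2)]
      qprod_closed[OF I_carrier assms(2)]
    unfolding I_def by (simp add: of_comm_mult del: comm_alg_simps)
qed

lemma I_qprod_left:
  assumes "f \<in> I" "g \<in> A"
  shows "qprod n q g f \<in> I"
proof -
  interpret ideal P "q_alg n q" by (rule ideal_P)
  show ?thesis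
    using I_l_closed[of "of_comm n q f" "of_comm n q g"] assms of_comm_closed[OF assms(2)]
      qprod_closed[OF assms(2) I_carrier]
    unfolding I_def by (simp add: of_comm_mult del: comm_alg_simps)
qed

lemma I_prime:
  assumes "f \<in> A" "g \<in> A" "qprod n q f g \<in> I"
  shows "f \<in> I \<or> g \<in> I"
  using assms prime of_comm_closed[OF assms(1)] of_comm_closed[OF assms(2)]
  unfolding I_def completely_prime_def by (auto simp: of_comm_mult simp del: comm_alg_simps)

lemma I_add: "f \<in> I \<Longrightarrow> g \<in> I \<Longrightarrow> f + g \<in> I"
proof -
  assume fg: "f \<in> I" "g \<in> I"
  interpret ideal P "q_alg n q" by (rule ideal_P)
  have "f + g \<in> A" using I_carrier[OF fg(1)] I_carrier[OF fg(2)] keys_add[of f g] by auto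
  then show ?thesis using a_closed fg
    unfolding I_def by (simp add: of_comm_add[symmetric] del: comm_alg_simps)
qed

lemma I_const_times:
  assumes "f \<in> I"
  shows "Poly_Mapping.single 0 c * f \<in> I"
proof -
  have "qprod n q (Poly_Mapping.single 0 c) f =
      scale (\<lambda>_. 1) (Poly_Mapping.single 0 c) * scale (\<lambda>_. 1) f"
    by (rule qprod_eq_scaled_times[OF comm_alg_const_closed I_carrier[OF assms]])
      (simp split: if_splits)
  then show ?thesis using I_qprod_left[OF assms comm_alg_const_closed, of c] by simp
qed

lemma one_notin_I: "1 \<notin> I"
proof
  assume one: "1 \<in> I"
  have "carrier (q_alg n q) \<subseteq> P"
  proof
    fix a assume "a \<in> carrier (q_alg n q)"
    then obtain f where f: "f \<in> A" "a = of_comm n q f"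
      using bij_betw_imp_surj_on[OF bij_betw_of_comm, of n q] by blast
    have "qprod n q 1 f = 1 * f"
      using qprod_eq_scaled_times[OF I_carrier[OF one] f(1), of q "\<lambda>_. 1" "\<lambda>_. 1"] by simp
    then show "a \<in> P" using I_qprod_right[OF one f(1)] f(2) unfolding I_def by simp
  qed
  moreover have "P \<subseteq> carrier (q_alg n q)"
    using additive_subgroup.a_subset[OF ideal.axioms(1)[OF ideal_P]] .
  ultimately show False using prime unfolding completely_prime_def by blast
qed

lemma q_power_inj: "q ^ a = q ^ b \<Longrightarrow> a = b"
proof -
  have "a = b" if "a \<le> b" "q ^ a = q ^ b" for a b
    using that q_not_root[rule_format, of "b - a"] q_nonzero power_add[of q a "b - a"] by (cases "a = b") auto
  then show "q ^ a = q ^ b \<Longrightarrow> a = b" by (metis nat_le_linear)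
qed

abbreviation X0 :: "(gen \<Rightarrow>\<^sub>0 nat) \<Rightarrow>\<^sub>0 'k"
  where "X0 \<equiv> Poly_Mapping.single (Poly_Mapping.single (XV 0) 1) 1"

abbreviation Y0 :: "(gen \<Rightarrow>\<^sub>0 nat) \<Rightarrow>\<^sub>0 'k"
  where "Y0 \<equiv> Poly_Mapping.single (Poly_Mapping.single (YV 0) 1) 1"

lemma X0_closed: "X0 \<in> A" and Y0_closed: "Y0 \<in> A"
  by (auto simp: gens_def)

text \<open>The first twist comes from \<open>f x = x (scale f)\<close>, the second from \<open>y f = (scale f) y\<close>, both
  read in the quotient algebra: the left-hand side is in the ideal, so primeness moves the twisted
  element into it.\<close>

lemma I_twist:
  assumes "f \<in> I"
  shows "X0 \<notin> I \<Longrightarrow> scale (\<lambda>m. q ^ ydeg n m) f \<in> I"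
    and "Y0 \<notin> I \<Longrightarrow> scale (\<lambda>m. q ^ xdeg n m) f \<in> I"
proof -
  have x1: "xdeg n (Poly_Mapping.single (XV 0) 1) = 1" "ydeg n (Poly_Mapping.single (YV 0) 1) = 1"
    by (simp_all add: xdeg_def ydeg_def lookup_single when_def)
  note f = I_carrier[OF assms]
  let ?y = "scale (\<lambda>m. q ^ ydeg n m) f" and ?x = "scale (\<lambda>m. q ^ xdeg n m) f"
  have "qprod n q f X0 = ?y * scale (\<lambda>_. 1) X0"
    by (rule qprod_eq_scaled_times[OF f X0_closed]) (simp add: x1[simplified])
  moreover have "qprod n q X0 ?y = scale (\<lambda>_. 1) X0 * scale (\<lambda>_. 1) ?y"
    by (rule qprod_eq_scaled_times[OF X0_closed comm_alg_scale_closed[OF f]]) simp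
  ultimately have "qprod n q X0 ?y \<in> I"
    using I_qprod_right[OF assms X0_closed] by (simp add: mult.commute)
  then show "?y \<in> I" if "X0 \<notin> I"
    using I_prime[OF X0_closed comm_alg_scale_closed[OF f]] that by blast
  have "qprod n q Y0 f = scale (\<lambda>_. 1) Y0 * ?x"
    by (rule qprod_eq_scaled_times[OF Y0_closed f]) (simp add: x1[simplified])
  moreover have "qprod n q ?x Y0 = scale (\<lambda>_. 1) ?x * scale (\<lambda>_. 1) Y0"
    by (rule qprod_eq_scaled_times[OF comm_alg_scale_closed[OF f] Y0_closed]) simp
  ultimately have "qprod n q ?x Y0 \<in> I"
    using I_qprod_left[OF assms Y0_closed] by (simp add: mult.commute)
  then show "?x \<in> I" if "Y0 \<notin> I"
    using I_prime[OF comm_alg_scale_closed[OF f] Y0_closed] that by blast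
qed

text \<open>Subtracting the right multiple of \<open>f\<close> from its twist kills exactly the monomials whose
  \<open>\<phi>\<close>-value is that of \<open>m\<^sub>0\<close>.\<close>

lemma exists_fewer_monomials:
  assumes f: "f \<in> I" and tw: "scale (\<lambda>m. q ^ \<phi> m) f \<in> I"
    and m: "m\<^sub>0 \<in> Poly_Mapping.keys f" "m\<^sub>1 \<in> Poly_Mapping.keys f" "\<phi> m\<^sub>0 \<noteq> \<phi> m\<^sub>1"
  shows "\<exists>g\<in>I. g \<noteq> 0 \<and> card (Poly_Mapping.keys g) < card (Poly_Mapping.keys f)"
proof -
  define g where "g = scale (\<lambda>m. q ^ \<phi> m) f + Poly_Mapping.single 0 (- (q ^ \<phi> m\<^sub>0)) * f"
  have l: "Poly_Mapping.lookup g m = (q ^ \<phi> m - q ^ \<phi> m\<^sub>0) * Poly_Mapping.lookup f m" for m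
    unfolding g_def scale_const[symmetric] by (simp add: lookup_add algebra_simps)
  have "g \<in> I" unfolding g_def using I_add[OF tw I_const_times[OF f]] .
  moreover have "m\<^sub>1 \<in> Poly_Mapping.keys g"
    using m q_power_inj[of "\<phi> m\<^sub>1" "\<phi> m\<^sub>0"] by (auto simp: in_keys_iff l)
  moreover have "Poly_Mapping.keys g \<subset> Poly_Mapping.keys f"
    using m(1) by (auto simp: in_keys_iff l)
  ultimately show ?thesis using psubset_card_mono[of "Poly_Mapping.keys f" "Poly_Mapping.keys g"]
    by (intro bexI[of _ g]) auto
qed

text \<open>If \<open>x\<close> or \<open>y\<close> is in the ideal, it is itself the desired element; otherwise both twists
  are available, and the number of monomials can be decreased until all bi-degrees agree.\<close>

lemma exists_bihomogeneous:
  assumes "f \<in> I" "f \<noteq> 0"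
  shows "\<exists>g\<in>I. g \<noteq> 0 \<and> bihomogeneous n g"
proof (cases "X0 \<in> I \<or> Y0 \<in> I")
  case True
  moreover have "bihomogeneous n X0" "bihomogeneous n Y0" by (auto simp: bihomogeneous_def)
  moreover have "X0 \<noteq> 0" "Y0 \<noteq> 0"
    by (metis lookup_single_eq lookup_zero one_neq_zero)+
  ultimately show ?thesis by blast
next
  case False
  show ?thesis using assms
  proof (induction "card (Poly_Mapping.keys f)" arbitrary: f rule: less_induct)
    case less
    show ?case
    proof (cases "bihomogeneous n f")
      case False
      then obtain m\<^sub>0 m\<^sub>1 where "m\<^sub>0 \<in> Poly_Mapping.keys f" "m\<^sub>1 \<in> Poly_Mapping.keys f"
        "xdeg n m\<^sub>0 \<noteq> xdeg n m\<^sub>1 \<or> ydeg n m\<^sub>0 \<noteq> ydeg n m\<^sub>1"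
        using bihomogeneousI by blast
      then have "\<exists>g\<in>I. g \<noteq> 0 \<and> card (Poly_Mapping.keys g) < card (Poly_Mapping.keys f)"
        using exists_fewer_monomials[OF less.prems(1) I_twist(2)[OF less.prems(1)]]
          exists_fewer_monomials[OF less.prems(1) I_twist(1)[OF less.prems(1)]] \<open>\<not> (X0 \<in> I \<or> Y0 \<in> I)\<close>
        by blast
      then show ?thesis using less.hyps by blast
    qed (use less.prems in blast)
  qed
qed

lemma bihomogeneous_qprod:
  assumes "f \<in> A" "g \<in> A" "bihomogeneous n f" "bihomogeneous n g"
  shows "\<exists>c. c \<noteq> 0 \<and> qprod n q f g = Poly_Mapping.single 0 c * (f * g)"
proof -
  obtain d e where
    d: "\<And>m. m \<in> Poly_Mapping.keys f \<Longrightarrow> bidegree n m = d" and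
    e: "\<And>m. m \<in> Poly_Mapping.keys g \<Longrightarrow> bidegree n m = e"
    using assms(3,4) unfolding bihomogeneous_def by blast
  let ?c = "q ^ (snd d * fst e)"
  have "q ^ (ydeg n m * xdeg n m') = ?c * 1"
    if "m \<in> Poly_Mapping.keys f" "m' \<in> Poly_Mapping.keys g" for m m'
    using d[OF that(1)] e[OF that(2)] unfolding bidegree_eq by auto
  from qprod_eq_scaled_times[OF assms(1,2) this]
  have "qprod n q f g = Poly_Mapping.single 0 ?c * (f * g)"
    by (simp add: scale_const mult.assoc)
  then show ?thesis using q_nonzero by (intro exI[of _ ?c]) simp
qed

lemma bihomogeneous_degree_zero_unit:
  assumes "f \<in> A" "f \<noteq> 0" "\<And>m. m \<in> Poly_Mapping.keys f \<Longrightarrow> xdeg n m + ydeg n m = 0"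
  shows "f \<in> Units (comm_alg n)"
proof -
  have "m = 0" if "m \<in> Poly_Mapping.keys f" for m
    using assms(3)[OF that] deg_eq_zero[of m n] assms(1) that by auto
  then have k: "Poly_Mapping.keys f \<subseteq> {0}" by blast
  define c where "c = Poly_Mapping.lookup f 0"
  have f: "f = Poly_Mapping.single 0 c"
    by (rule poly_mapping_eqI) (use k in \<open>auto simp: c_def lookup_single when_def in_keys_iff\<close>)
  then have "c \<noteq> 0" using assms(2) by auto
  then show ?thesis unfolding Units_def f
    by (auto intro!: exI[of _ "Poly_Mapping.single 0 (inverse c)"] simp: mult_single)
qed

text \<open>Descent on the total degree \<open>d\<close>: it drops strictly for each factor of a reducible element,
  because the bi-homogeneous polynomials of degree zero are constants, hence units.\<close>

lemma exists_irreducible: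
  assumes "f \<in> I" "f \<noteq> 0" "bihomogeneous n f" "\<And>m. m \<in> Poly_Mapping.keys f \<Longrightarrow> xdeg n m + ydeg n m = d"
  shows "\<exists>g\<in>I. bihomogeneous n g \<and> ring_irreducible\<^bsub>comm_alg n\<^esub> g"
  using assms
proof (induction d arbitrary: f rule: less_induct)
  case (less d)
  interpret R: cring "comm_alg n :: ((gen \<Rightarrow>\<^sub>0 nat) \<Rightarrow>\<^sub>0 'k) ring" by (rule cring_comm_alg)
  note f = I_carrier[OF less.prems(1)]
  show ?case
  proof (cases "ring_irreducible\<^bsub>comm_alg n\<^esub> f")
    case True
    then show ?thesis using less.prems by blast
  next
    case False
    \<comment> \<open>the inverse of a unit \<open>f\<close> would be bi-homogeneous, hence also its inverse for \<open>qprod\<close> up to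
      a scalar, and the ideal would contain \<open>1\<close>\<close>
    have "f \<notin> Units (comm_alg n)"
    proof
      assume "f \<in> Units (comm_alg n)"
      then obtain u where u: "u \<in> A" "f * u = 1"
        unfolding Units_def by (auto simp del: comm_alg_simps(1))
      have "bihomogeneous n (f * u)" unfolding u(2) by (auto simp: bihomogeneous_def)
      from bihomogeneous_factor(2)[OF this] have "bihomogeneous n u" using u(2) by simp
      then obtain c where c: "c \<noteq> 0" "qprod n q f u = Poly_Mapping.single 0 c"
        using bihomogeneous_qprod[OF f u(1) less.prems(3)] u(2) by auto
      have "Poly_Mapping.single 0 (inverse c) * qprod n q f u \<in> I"
        using I_const_times[OF I_qprod_right[OF less.prems(1) u(1)]] .
      then show False using one_notin_I c by (simp add: mult_single)
    qed
    then obtain b where b: "b \<in> A" "b \<notin> Units (comm_alg n)" "b divides\<^bsub>comm_alg n\<^esub> f"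
      "\<not> f divides\<^bsub>comm_alg n\<^esub> b"
      using False less.prems(2) unfolding ring_irreducible_def irreducible_def properfactor_def by auto
    then obtain c where c: "c \<in> A" "f = b * c"
      unfolding factor_def by (auto simp del: comm_alg_simps(1))
    \<comment> \<open>a unit \<open>c\<close> would make \<open>f\<close> a divisor of its proper factor \<open>b\<close>\<close>
    have cu: "c \<notin> Units (comm_alg n)"
    proof
      assume "c \<in> Units (comm_alg n)"
      then obtain u where u: "u \<in> A" "c * u = 1"
        unfolding Units_def by (auto simp del: comm_alg_simps(1))
      have "b = f * u" unfolding c(2) mult.assoc u(2) by simp
      then show False using b(4) u(1) unfolding factor_def by (auto simp del: comm_alg_simps(1))
    qed
    have nz: "b \<noteq> 0" "c \<noteq> 0" using less.prems(2) c(2) by auto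
    have hom: "bihomogeneous n b" "bihomogeneous n c"
      using bihomogeneous_factor[of n b c] less.prems(2,3) c(2) by auto
    obtain l m where l: "l \<in> Poly_Mapping.keys b" and m: "m \<in> Poly_Mapping.keys c" using nz nonzero_has_key by blast
    define dl dm where "dl = xdeg n l + ydeg n l" and "dm = xdeg n m + ydeg n m"
    have dl: "xdeg n k + ydeg n k = dl" if "k \<in> Poly_Mapping.keys b" for k
      unfolding dl_def using bihomogeneousD[OF hom(1) that l] by simp
    have dm: "xdeg n k + ydeg n k = dm" if "k \<in> Poly_Mapping.keys c" for k
      unfolding dm_def using bihomogeneousD[OF hom(2) that m] by simp
    obtain k where k: "k \<in> Poly_Mapping.keys (b * c)" using less.prems(2) c(2) nonzero_has_key by blast
    then obtain l' m' where lm: "k = l' + m'" "l' \<in> Poly_Mapping.keys b" "m' \<in> Poly_Mapping.keys c"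
      using keys_mult[of b c] by blast
    have "d = dl + dm" using less.prems(4)[of k] k dl[OF lm(2)] dm[OF lm(3)]
      unfolding c(2) lm(1) by (simp add: deg_add)
    moreover have "dl \<noteq> 0" using bihomogeneous_degree_zero_unit[OF b(1) nz(1)] dl b(2) by blast
    moreover have "dm \<noteq> 0" using bihomogeneous_degree_zero_unit[OF c(1) nz(2)] dm cu by blast
    ultimately have lt: "dl < d" "dm < d" by auto
    have "b \<in> I \<or> c \<in> I"
      using bihomogeneous_qprod[OF b(1) c(1) hom] I_const_times[OF less.prems(1)] I_prime[OF b(1) c(1)] c(2)
      by metis
    then show ?thesis
      using less.IH[OF lt(1) _ nz(1) hom(1) dl] less.IH[OF lt(2) _ nz(2) hom(2) dm] by blast
  qed
qed

end

theorem theorem1: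
  fixes q :: "'k::field" and n :: nat and P :: "(gen word \<Rightarrow>\<^sub>0 'k) set set"
  assumes "q \<noteq> 0"
    and "\<forall>m::nat. m > 0 \<longrightarrow> q ^ m \<noteq> 1"
    and "completely_prime P (q_alg n q)"
    and "P \<noteq> {\<zero>\<^bsub>q_alg n q\<^esub>}"
  shows "\<exists>a\<in>P. a \<noteq> \<zero>\<^bsub>q_alg n q\<^esub> \<and> bihomogeneous n (to_comm n q a) \<and>
    ring_irreducible\<^bsub>comm_alg n\<^esub> (to_comm n q a)"
proof -
  interpret generic_completely_prime n q P
    by (rule generic_completely_prime.intro) (fact assms)+
  have sub: "additive_subgroup P (q_alg n q)" by (rule ideal.axioms(1)[OF ideal_P])
  from additive_subgroup.zero_closed[OF sub] assms(4)
  have "\<exists>a\<in>P. a \<noteq> \<zero>\<^bsub>q_alg n q\<^esub>" by auto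
  then obtain a where a: "a \<in> P" "a \<noteq> \<zero>\<^bsub>q_alg n q\<^esub>" by blast
  have "a \<in> of_comm n q ` A"
    unfolding bij_betw_imp_surj_on[OF bij_betw_of_comm]
    by (rule subsetD[OF additive_subgroup.a_subset[OF sub] a(1)])
  then obtain f where f: "f \<in> A" "a = of_comm n q f" by blast
  then have "f \<in> I" "f \<noteq> 0" using a of_comm_zero[of n q] by (auto simp: I_def simp del: comm_alg_simps)
  then obtain g where g: "g \<in> I" "g \<noteq> 0" "bihomogeneous n g"
    using exists_bihomogeneous by blast
  then obtain m where m: "m \<in> Poly_Mapping.keys g" using nonzero_has_key by blast
  obtain h where h: "h \<in> I" "bihomogeneous n h" "ring_irreducible\<^bsub>comm_alg n\<^esub> h"
    using exists_irreducible[OF g] bihomogeneousD[OF g(3) _ m] by metis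
  have "h \<noteq> 0" using h(3) by (auto simp: ring_irreducible_def)
  then have "of_comm n q h \<noteq> \<zero>\<^bsub>q_alg n q\<^esub>"
    using to_comm_of_comm[OF I_carrier[OF h(1)], of q] to_comm_of_comm[of 0 n q] of_comm_zero[of n q] by auto
  then show ?thesis
    using h to_comm_of_comm[OF I_carrier[OF h(1)], of q] unfolding I_def
    by (intro bexI[of _ "of_comm n q h"]) auto
qed

end
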